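(* For all $\alpha>0$, $k^t\in\mathbb{N}$, $k^d\in\mathbb{N}$, the worst-case drone-impact ratio of the policy Optimistic satisfies $$\bar{\omega}(\mathrm{Optimistic})\ \le\ \min\left\{2,\ \frac{1}{\alpha}\left\lceil\frac{k^t}{k^d}\right\rceil+1\right\}.$$
   Context: Relief distribution problem (RDP). $\mathbb{N}=\{1,2,\dots\}$. An instance is $I=(k^t,k^d,\alpha,G,D)$: $k^t,k^d\in\mathbb{N}$ are the numbers of trucks and drones; $\alpha>0$ is the drone speed; $G=(V,E,c)$ is a finite connected undirected graph (not necessarily complete) with $V=\{v_0\}\cup C$, where $v_0$ is the depot and $C\neq\emptyset$ is the set of non-depot nodes; edge lengths $c(i,j)>0$ satisfy the triangle inequality; $D\subseteq C$ is the set of damaged nodes, initially unknown; the status of a node is revealed when some vehicle first arrives at it. For non-adjacent $i,j$, $c(i,j)$ is the shortest-path distance. A truck needs time $c(i,j)$ to traverse an edge, a drone needs $\frac1\alpha c(i,j)$. A tour is a closed walk in $G$ starting and ending at $v_0$ (possibly of length $0$); it visits all nodes lying on it. The makespan of a family of tours is the maximum duration of a tour. For integers $m,n\ge 0$ with $m+n\ge1$ and $W\subseteq C$, $\mathrm{TSP}_{m,n}(W)$ denotes the minimum makespan over all families of $m$ truck tours and $n$ drone tours that together visit all nodes of $W$, and $S^*_{m,n}(W)$ denotes an optimal such family. Policy Optimistic (deterministic; optimal families are selected by a fixed rule based only on the information available at that time, so the first-stage tours do not depend on $D$). First stage: the vehicles execute the tours of $S^*_{k^t,k^d}(C)$ and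 return to the depot. Let $D^d\subseteq D$ be the set of damaged nodes not visited by truck tours in this stage. Second stage (after all vehicles returned): the trucks execute $S^*_{k^t,0}(D^d)$. Its makespan is $\mathrm{Optimistic}(I)=\mathrm{TSP}_{k^t,k^d}(C)+\mathrm{TSP}_{k^t,0}(D^d)$. Worst-case drone-impact ratio: $\bar{\omega}(\mathrm{Optimistic})=\sup_I \frac{\mathrm{Optimistic}(I)}{\mathrm{TSP}_{k^t,0}(C)}$, the supremum being over all instances $I$ with the given $k^t,k^d,\alpha$ (and $C=C(I)$). *)

theory Defs
  imports
    Complex_Main
    "HOL-Library.Extended_Real"
    "Graph_Theory.Graph_Theory"
begin

type_synonym 'v tour = "('v \<times> 'v) awalk"

text \<open>A family of tours: the truck tours, then the drone tours.\<close>
type_synonym 'v family = "'v tour list \<times> 'v tour list"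

definition (in pair_graph) node_dist :: "('a \<times> 'a \<Rightarrow> real) \<Rightarrow> 'a \<Rightarrow> 'a \<Rightarrow> ereal" where
  "node_dist c i j = (if (i, j) \<in> parcs G then ereal (c (i, j)) else \<mu> c i j)"

text \<open>
  An undirected graph is a symmetric loop-free digraph, whose two arcs between adjacent
  nodes have the same length. The triangle inequality is imposed on the extension of the
  edge lengths to all pairs of nodes; for \<open>i = j\<close> this extension is \<open>0\<close>.
\<close>
locale relief_network = pair_graph G for G :: "'v pair_pre_digraph" +
  fixes c :: "'v \<times> 'v \<Rightarrow> real" and depot :: 'v and \<alpha> :: real
  assumes connected: "connected (with_proj G)"
    and depot_in: "depot \<in> pverts G"
    and customers_nonempty: "pverts G - {depot} \<noteq> {}"
    and length_sym: "(i, j) \<in> parcs G \<Longrightarrow> c (i, j) = c (j, i)"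
    and length_pos: "e \<in> parcs G \<Longrightarrow> 0 < c e"
    and triangle: "\<lbrakk>i \<in> pverts G; j \<in> pverts G; k \<in> pverts G\<rbrakk>
      \<Longrightarrow> node_dist c i j \<le> node_dist c i k + node_dist c k j"
    and speed_pos: "0 < \<alpha>"
begin

definition customers :: "'v set" where
  "customers = pverts G - {depot}"

definition is_tour :: "'v tour \<Rightarrow> bool" where
  "is_tour p \<longleftrightarrow> awalk depot p depot"

definition visited :: "'v tour list \<Rightarrow> 'v set" where
  "visited ps = (\<Union>p\<in>set ps. set (awalk_verts depot p))"

definition truck_time :: "'v tour \<Rightarrow> real" where
  "truck_time p = awalk_cost c p"

definition drone_time :: "'v tour \<Rightarrow> real" where
  "drone_time p = awalk_cost (\<lambda>e. 1 / \<alpha> * c e) p"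

definition families :: "nat \<Rightarrow> nat \<Rightarrow> 'v set \<Rightarrow> 'v family set" where
  "families m n W = {(Ts, Ds). length Ts = m \<and> length Ds = n \<and>
     (\<forall>p\<in>set Ts \<union> set Ds. is_tour p) \<and> W \<subseteq> visited (Ts @ Ds)}"

definition makespan :: "'v family \<Rightarrow> real" where
  "makespan F = Max (truck_time ` set (fst F) \<union> drone_time ` set (snd F))"

text \<open>The infimum is a minimum, see \<open>optimal_family_exists\<close> and \<open>TSP_attained\<close> below.\<close>
definition TSP :: "nat \<Rightarrow> nat \<Rightarrow> 'v set \<Rightarrow> real" where
  "TSP m n W = (INF F\<in>families m n W. makespan F)"

definition optimal_family :: "nat \<Rightarrow> nat \<Rightarrow> 'v set \<Rightarrow> 'v family \<Rightarrow> bool" where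
  "optimal_family m n W F \<longleftrightarrow> is_arg_min makespan (\<lambda>F. F \<in> families m n W) F"

end

text \<open>
  A selection rule fixes one optimal family for every network, all numbers of vehicles and
  every set of nodes to be visited. The set of damaged nodes is not among its arguments, so
  the first-stage tours cannot depend on it.
\<close>
type_synonym 'v selection =
  "'v pair_pre_digraph \<Rightarrow> ('v \<times> 'v \<Rightarrow> real) \<Rightarrow> 'v \<Rightarrow> real \<Rightarrow> nat \<Rightarrow> nat \<Rightarrow> 'v set \<Rightarrow> 'v family"

definition selection_rule :: "'v selection \<Rightarrow> bool" where
  "selection_rule S \<longleftrightarrow>
     (\<forall>G c depot \<alpha> m n W. relief_network G c depot \<alpha> \<and> 1 \<le> m + n \<and>
        W \<subseteq> relief_network.customers G depot \<longrightarrow>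
        relief_network.optimal_family G c depot \<alpha> m n W (S G c depot \<alpha> m n W))"

context relief_network
begin

definition truck_missed :: "'v selection \<Rightarrow> nat \<Rightarrow> nat \<Rightarrow> 'v set \<Rightarrow> 'v set" where
  "truck_missed S k\<^sub>t k\<^sub>d D = D - visited (fst (S G c depot \<alpha> k\<^sub>t k\<^sub>d customers))"

definition Optimistic :: "'v selection \<Rightarrow> nat \<Rightarrow> nat \<Rightarrow> 'v set \<Rightarrow> real" where
  "Optimistic S k\<^sub>t k\<^sub>d D = TSP k\<^sub>t k\<^sub>d customers + TSP k\<^sub>t 0 (truck_missed S k\<^sub>t k\<^sub>d D)"

definition drone_impact :: "'v selection \<Rightarrow> nat \<Rightarrow> nat \<Rightarrow> 'v set \<Rightarrow> real" where
  "drone_impact S k\<^sub>t k\<^sub>d D = Optimistic S k\<^sub>t k\<^sub>d D / TSP k\<^sub>t 0 customers"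

end

text \<open>
  The supremum ranges over all instances whose nodes are of type \<open>'v\<close>; for an infinite type
  these are all instances up to isomorphism.
\<close>
definition worst_case_drone_impact :: "'v selection \<Rightarrow> nat \<Rightarrow> nat \<Rightarrow> real \<Rightarrow> ereal" where
  "worst_case_drone_impact S k\<^sub>t k\<^sub>d \<alpha> =
     (SUP (G, c, depot, D) \<in> {(G, c, depot, D). relief_network G c depot \<alpha> \<and>
         D \<subseteq> relief_network.customers G depot}.
       ereal (relief_network.drone_impact G c depot \<alpha> S k\<^sub>t k\<^sub>d D))"

text \<open>
  Optimal families exist, so the infimum in \<open>TSP\<close> is a minimum, selection rules exist, and the
  denominator of the ratio is positive.
\<close>
context relief_network
begin

lemma tour_through:
  assumes "w \<in> pverts G"
  shows "\<exists>p. is_tour p \<and> w \<in> set (awalk_verts depot p)"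
proof -
  have sc: "strongly_connected (with_proj G)"
    using connected sym_arcs by (intro symmetric_connected_imp_strongly_connected)
  have "depot \<rightarrow>\<^sup>*\<^bsub>with_proj G\<^esub> w" "w \<rightarrow>\<^sup>*\<^bsub>with_proj G\<^esub> depot"
    using sc assms depot_in by (auto simp: strongly_connected_def)
  then obtain p q where pq: "awalk depot p w" "awalk w q depot"
    by (auto simp: reachable_awalk)
  then have "awalk depot (p @ q) depot" by (rule awalk_appendI)
  moreover have "w \<in> set (awalk_verts depot (p @ q))"
    using set_awalk_verts_append[OF pq] hd_in_awalk_verts(1)[OF pq(2)] by simp
  ultimately show ?thesis unfolding is_tour_def by blast
qed

lemma grand_tour:
  assumes "W \<subseteq> pverts G"
  shows "\<exists>p. is_tour p \<and> W \<subseteq> set (awalk_verts depot p)"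
proof -
  have "finite W" using assms pair_finite_verts finite_subset by blast
  then show ?thesis using assms
  proof (induction W)
    case empty
    have "is_tour []" by (simp add: is_tour_def awalk_Nil_iff depot_in)
    then show ?case by blast
  next
    case (insert w W)
    then obtain p q where p: "is_tour p" "W \<subseteq> set (awalk_verts depot p)"
      and q: "is_tour q" "w \<in> set (awalk_verts depot q)"
      using tour_through[of w] by auto
    have aw: "awalk depot p depot" "awalk depot q depot" using p q by (auto simp: is_tour_def)
    have "is_tour (p @ q)" using awalk_appendI[OF aw] by (simp add: is_tour_def)
    moreover have "insert w W \<subseteq> set (awalk_verts depot (p @ q))"
      using set_awalk_verts_append[OF aw] p q by auto
    ultimately show ?case by blast
  qed
qed

lemma families_nonempty:
  assumes "1 \<le> m + n" "W \<subseteq> pverts G"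
  shows "families m n W \<noteq> {}"
proof -
  obtain p where p: "is_tour p" "W \<subseteq> set (awalk_verts depot p)"
    using grand_tour[OF assms(2)] by blast
  have "(replicate m p, replicate n p) \<in> families m n W"
    using p assms(1) by (auto simp: families_def visited_def set_replicate_conv_if)
  then show ?thesis by blast
qed

lemma ex_min_rate: "\<exists>\<delta>>0. \<forall>e\<in>parcs G. \<delta> \<le> c e \<and> \<delta> \<le> 1 / \<alpha> * c e"
proof -
  define X where "X = insert 1 (c ` parcs G \<union> (\<lambda>e. 1 / \<alpha> * c e) ` parcs G)"
  have fin: "finite X" using pair_finite_arcs by (simp add: X_def)
  have "\<forall>x\<in>X. 0 < x" using length_pos speed_pos by (auto simp: X_def)
  moreover have "Min X \<in> X" using fin by (intro Min_in) (auto simp: X_def)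
  ultimately have "0 < Min X" by blast
  moreover have "\<forall>e\<in>parcs G. Min X \<le> c e \<and> Min X \<le> 1 / \<alpha> * c e"
    using fin by (auto intro!: Min_le simp: X_def)
  ultimately show ?thesis by blast
qed

lemma cost_ge:
  assumes "\<forall>e\<in>parcs G. \<delta> \<le> f e" "set p \<subseteq> parcs G"
  shows "\<delta> * real (length p) \<le> awalk_cost f p"
  using assms(2)
proof (induction p)
  case (Cons e p)
  then have "\<delta> \<le> f e" using assms(1) by auto
  with Cons show ?case by (simp add: algebra_simps)
qed simp

lemma time_le_makespan:
  "p \<in> set (fst F) \<Longrightarrow> truck_time p \<le> makespan F"
  "p \<in> set (snd F) \<Longrightarrow> drone_time p \<le> makespan F"
  unfolding makespan_def by (rule Max_ge; simp)+

lemma finite_families_bounded: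
  assumes "1 \<le> m + n"
  shows "finite {F \<in> families m n W. makespan F \<le> B}"
proof -
  obtain \<delta> where d: "0 < \<delta>" "\<forall>e\<in>parcs G. \<delta> \<le> c e" "\<forall>e\<in>parcs G. \<delta> \<le> 1 / \<alpha> * c e"
    using ex_min_rate by blast
  define L where "L = nat \<lceil>B / \<delta>\<rceil>"
  define A where "A = {p. set p \<subseteq> parcs G \<and> length p \<le> L}"
  have A: "finite A" unfolding A_def by (rule finite_lists_length_le[OF pair_finite_arcs])
  have inA: "p \<in> A" if "awalk_cost f p \<le> B" "\<forall>e\<in>parcs G. \<delta> \<le> f e" "is_tour p" for f p
  proof -
    have s: "set p \<subseteq> parcs G" using that(3) by (auto simp: is_tour_def)
    have "\<delta> * real (length p) \<le> B" using cost_ge[OF that(2) s] that(1) by simp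
    then have "real (length p) \<le> B / \<delta>" using d(1) by (simp add: field_simps)
    then have "length p \<le> L" unfolding L_def by linarith
    then show ?thesis using s by (simp add: A_def)
  qed
  have "{F \<in> families m n W. makespan F \<le> B} \<subseteq>
      {xs. set xs \<subseteq> A \<and> length xs = m} \<times> {xs. set xs \<subseteq> A \<and> length xs = n}"
  proof
    fix F assume F: "F \<in> {F \<in> families m n W. makespan F \<le> B}"
    obtain Ts Ds where [simp]: "F = (Ts, Ds)" by (cases F)
    have fam: "length Ts = m" "length Ds = n" "\<forall>p\<in>set Ts \<union> set Ds. is_tour p"
      and mk: "makespan (Ts, Ds) \<le> B"
      using F by (auto simp: families_def)
    have "\<forall>p\<in>set Ts. awalk_cost c p \<le> B"
      "\<forall>p\<in>set Ds. awalk_cost (\<lambda>e. 1 / \<alpha> * c e) p \<le> B"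
      using mk time_le_makespan[of _ "(Ts, Ds)"]
      by (auto simp: truck_time_def drone_time_def intro: order_trans)
    then have "set Ts \<subseteq> A" "set Ds \<subseteq> A"
      using fam(3) inA[OF _ d(2)] inA[OF _ d(3)] by blast+
    then show "F \<in> {xs. set xs \<subseteq> A \<and> length xs = m} \<times> {xs. set xs \<subseteq> A \<and> length xs = n}"
      using fam by simp
  qed
  then show ?thesis
    by (rule finite_subset) (intro finite_SigmaI finite_lists_length_eq A)
qed

lemma optimal_family_exists:
  assumes "1 \<le> m + n" "W \<subseteq> customers"
  shows "\<exists>F. optimal_family m n W F"
proof -
  have "W \<subseteq> pverts G" using assms(2) by (auto simp: customers_def)
  then obtain F0 where F0: "F0 \<in> families m n W"
    using families_nonempty[OF assms(1)] by blast
  let ?Y = "{F \<in> families m n W. makespan F \<le> makespan F0}"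
  have "F0 \<in> ?Y" using F0 by simp
  then have "finite ?Y" "?Y \<noteq> {}" using finite_families_bounded[OF assms(1)] by blast+
  then obtain F where "is_arg_min makespan (\<lambda>F. F \<in> ?Y) F"
    using ex_is_arg_min_if_finite by blast
  then have F: "F \<in> ?Y" "\<forall>F'\<in>?Y. makespan F \<le> makespan F'"
    unfolding is_arg_min_linorder by blast+
  have "makespan F \<le> makespan F'" if "F' \<in> families m n W" for F'
  proof (cases "makespan F' \<le> makespan F0")
    case True
    then show ?thesis using F(2) that by blast
  next
    case False
    then show ?thesis using F(1) by simp
  qed
  then have "optimal_family m n W F"
    using F(1) unfolding optimal_family_def is_arg_min_linorder by simp
  then show ?thesis ..
qed

lemma TSP_attained:
  assumes "optimal_family m n W F"
  shows "F \<in> families m n W" "TSP m n W = makespan F"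
    "\<And>F'. F' \<in> families m n W \<Longrightarrow> TSP m n W \<le> makespan F'"
proof -
  show F: "F \<in> families m n W" using assms by (simp add: optimal_family_def is_arg_min_linorder)
  have le: "makespan F \<le> makespan F'" if "F' \<in> families m n W" for F'
    using assms that unfolding optimal_family_def is_arg_min_linorder by blast
  show eq: "TSP m n W = makespan F"
    unfolding TSP_def using F le by (intro cInf_eq_minimum) auto
  show "\<And>F'. F' \<in> families m n W \<Longrightarrow> TSP m n W \<le> makespan F'"
    using le eq by simp
qed

lemma TSP_trucks_pos:
  assumes "1 \<le> k"
  shows "0 < TSP k 0 customers"
proof -
  obtain F where "optimal_family k 0 customers F"
    using optimal_family_exists[of k 0 customers] assms by auto
  note F = TSP_attained[OF this]
  obtain Ts where Ts: "F = (Ts, [])" "\<forall>p\<in>set Ts. is_tour p" "customers \<subseteq> visited Ts"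
    using F(1) by (auto simp: families_def)
  obtain w where w: "w \<in> customers" using customers_nonempty by (auto simp: customers_def)
  then obtain p where p: "p \<in> set Ts" "w \<in> set (awalk_verts depot p)"
    using Ts by (auto simp: visited_def)
  have "p \<noteq> []" using p(2) w by (auto simp: customers_def)
  obtain \<delta> where d: "0 < \<delta>" "\<forall>e\<in>parcs G. \<delta> \<le> c e" using ex_min_rate by blast
  have "set p \<subseteq> parcs G" using Ts p by (auto simp: is_tour_def)
  then have "\<delta> * real (length p) \<le> truck_time p"
    using cost_ge[OF d(2)] by (simp add: truck_time_def)
  moreover have "0 < \<delta> * real (length p)" using d(1) \<open>p \<noteq> []\<close> by simp
  moreover have "truck_time p \<le> makespan F"
    using p time_le_makespan(1)[of p F] Ts(1) by simp
  ultimately show ?thesis using F(2) by linarith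
qed

end

lemma selection_rule_exists: "\<exists>S :: 'v selection. selection_rule S"
proof -
  let ?opt = "\<lambda>G c depot \<alpha> m n W F. relief_network.optimal_family G c depot \<alpha> m n W F"
  have opt: "?opt G c depot \<alpha> m n W (SOME F. ?opt G c depot \<alpha> m n W F)"
    if "relief_network G c depot \<alpha>" "1 \<le> m + n" "W \<subseteq> relief_network.customers G depot"
    for G c depot \<alpha> m n and W :: "'v set"
    by (rule someI_ex) (rule relief_network.optimal_family_exists[OF that])
  have "selection_rule (\<lambda>G c (depot :: 'v) \<alpha> m n W. SOME F. ?opt G c depot \<alpha> m n W F)"
    unfolding selection_rule_def by (intro allI impI, elim conjE) (rule opt)
  then show ?thesis by blast
qed

end

theory Submission
  imports Defs
begin

text \<open>
  The second stage is never longer than the trucks-only optimum, since it only has to cover a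
  subset of the nodes. An optimal trucks-only family bounds the first stage in two ways: the
  drones may stay at the depot, or the trucks may stay at the depot while each drone performs
  \<open>\<lceil>k\<^sub>t / k\<^sub>d\<rceil>\<close> of the truck tours in succession, at speed \<open>\<alpha>\<close>.
\<close>

context relief_network
begin

lemma makespan_leI:
  assumes "F \<in> families m n W" "1 \<le> m + n"
    and "\<And>p. p \<in> set (fst F) \<Longrightarrow> truck_time p \<le> B"
    and "\<And>p. p \<in> set (snd F) \<Longrightarrow> drone_time p \<le> B"
  shows "makespan F \<le> B"
proof -
  \<comment> \<open>At least one vehicle exists, so the \<open>Max\<close> in
    \<open>makespan\<close> ranges over a nonempty set.\<close>
  have "fst F \<noteq> [] \<or> snd F \<noteq> []"
    using assms(1,2) by (cases F) (auto simp: families_def)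
  then show ?thesis
    unfolding makespan_def using assms(3,4) by (subst Max_le_iff) auto
qed

lemma TSP_optimum:
  assumes "1 \<le> m + n" "W \<subseteq> customers"
  obtains F where "F \<in> families m n W" "TSP m n W = makespan F"
  using optimal_family_exists[OF assms] TSP_attained by blast

lemma TSP_le_makespan:
  assumes "1 \<le> m + n" "W \<subseteq> customers" "F \<in> families m n W"
  shows "TSP m n W \<le> makespan F"
  using optimal_family_exists[OF assms(1,2)] TSP_attained(3) assms(3) by blast

lemma TSP_mono:
  assumes "1 \<le> m + n" "W' \<subseteq> W" "W \<subseteq> customers"
  shows "TSP m n W' \<le> TSP m n W"
proof -
  obtain F where F: "F \<in> families m n W" "TSP m n W = makespan F"
    using TSP_optimum[OF assms(1,3)] .
  have "F \<in> families m n W'" using F(1) assms(2) by (auto simp: families_def)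
  then show ?thesis using TSP_le_makespan[OF assms(1)] assms(2,3) F(2) by auto
qed

text \<open>Supplies the tours that both first-stage bounds reuse, each no longer than the
  trucks-only optimum.\<close>

lemma trucks_optimum:
  assumes "1 \<le> m" "W \<subseteq> customers"
  obtains Ts where "length Ts = m" "\<forall>p\<in>set Ts. is_tour p" "W \<subseteq> visited Ts"
    "\<forall>p\<in>set Ts. truck_time p \<le> TSP m 0 W"
proof -
  obtain F where F: "F \<in> families m 0 W" "TSP m 0 W = makespan F"
    using TSP_optimum[of m 0 W] assms by auto
  show thesis
    using that[of "fst F"] F time_le_makespan(1)[of _ F] by (auto simp: families_def)
qed

lemma is_tour_Nil: "is_tour []"
  by (simp add: is_tour_def awalk_Nil_iff depot_in)

lemma TSP_le_TSP_trucks: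
  assumes "1 \<le> m"
  shows "TSP m n customers \<le> TSP m 0 customers"
proof -
  obtain Ts where Ts: "length Ts = m" "\<forall>p\<in>set Ts. is_tour p" "customers \<subseteq> visited Ts"
    "\<forall>p\<in>set Ts. truck_time p \<le> TSP m 0 customers"
    using trucks_optimum[OF assms order_refl] .
  let ?F = "(Ts, replicate n [])"
  have F: "?F \<in> families m n customers"
    using Ts is_tour_Nil by (auto simp: families_def visited_def)
  \<comment> \<open>The empty drone tours last time 0, which is below the bound because the optimum
    is positive.\<close>
  have "makespan ?F \<le> TSP m 0 customers"
    using makespan_leI[OF F] Ts(4) assms TSP_trucks_pos[OF assms]
    by (simp add: drone_time_def)
  then show ?thesis
    using TSP_le_makespan[OF _ order_refl F] assms by simp
qed

lemma drone_time_eq: "drone_time p = 1 / \<alpha> * truck_time p"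
  unfolding drone_time_def truck_time_def by (induction p) (simp_all add: algebra_simps)

lemma is_tour_append: "is_tour p \<Longrightarrow> is_tour q \<Longrightarrow> is_tour (p @ q)"
  unfolding is_tour_def by (rule awalk_appendI)

lemma is_tour_concat:
  assumes "\<forall>p\<in>set ps. is_tour p"
  shows "is_tour (concat ps)"
  using assms
  by (induction ps) (simp_all add: is_tour_Nil is_tour_append)

text \<open>All tours are closed at the depot, so they can be run one after another without losing a
  node.\<close>

lemma tour_verts_subset_concat:
  assumes "\<forall>p\<in>set ps. is_tour p" "p \<in> set ps"
  shows "set (awalk_verts depot p) \<subseteq> set (awalk_verts depot (concat ps))"
  using assms
proof (induction ps)
  case (Cons q ps)
  have "awalk depot q depot" "awalk depot (concat ps) depot"
    using Cons.prems(1) is_tour_concat[of ps] by (auto simp: is_tour_def)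
  from set_awalk_verts_append[OF this] show ?case
    using Cons by auto
qed simp

lemma truck_time_concat_le:
  assumes "\<forall>p\<in>set ps. truck_time p \<le> B"
  shows "truck_time (concat ps) \<le> real (length ps) * B"
  using assms
  by (induction ps) (fastforce simp: truck_time_def algebra_simps)+

text \<open>Cut the optimal truck tours into \<open>n\<close> consecutive chunks of at most
  \<open>q\<close> tours and let each drone fly one chunk. Any \<open>q\<close> with
  \<open>m \<le> n * q\<close> will do; the ceiling is substituted later.\<close>

lemma TSP_le_drones:
  assumes "1 \<le> m" "1 \<le> n" "m \<le> n * q"
  shows "TSP m n customers \<le> 1 / \<alpha> * real q * TSP m 0 customers"
proof -
  let ?B = "TSP m 0 customers"
  obtain Ts where Ts: "length Ts = m" "\<forall>p\<in>set Ts. is_tour p" "customers \<subseteq> visited Ts"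
    "\<forall>p\<in>set Ts. truck_time p \<le> ?B"
    using trucks_optimum[OF assms(1) order_refl] .
  have B: "0 \<le> ?B" using TSP_trucks_pos[OF assms(1)] by simp
  \<comment> \<open>Chunk \<open>j\<close> holds the tours with indices from \<open>j * q\<close> up
    to \<open>j * q + q - 1\<close>, as far as they exist; late chunks may be short or
    empty.\<close>
  define chunk where "chunk j = take q (drop (j * q) Ts)" for j
  let ?F = "(replicate m [], map (concat \<circ> chunk) [0..<n])"
  have sub: "set (chunk j) \<subseteq> set Ts" for j
    using set_take_subset set_drop_subset unfolding chunk_def by fastforce
  have tours: "\<forall>p\<in>set (chunk j). is_tour p" for j using Ts(2) sub by blast
  have "visited Ts \<subseteq> visited (snd ?F)"
  proof
    fix v assume "v \<in> visited Ts"
    then obtain p where "p \<in> set Ts" "v \<in> set (awalk_verts depot p)"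
      by (auto simp: visited_def)
    then obtain i where i: "i < m" "v \<in> set (awalk_verts depot (Ts ! i))"
      using Ts(1) by (metis in_set_conv_nth)
    \<comment> \<open>With \<open>q = 0\<close> there would be no truck tour at all, contradicting
      \<open>i < m\<close>.\<close>
    have "0 < q" using i(1) assms(3) by (cases q) auto
    have j: "i div q < n"
      using i(1) assms(3) by (simp add: less_mult_imp_div_less)
    \<comment> \<open>Division with remainder, \<open>i = (i div q) * q + i mod q\<close>, locates
      tour \<open>i\<close> in its chunk.\<close>
    have "chunk (i div q) ! (i mod q) = Ts ! i"
      using \<open>0 < q\<close> i(1) Ts(1) le_trans[OF div_times_less_eq_dividend[of i q] less_imp_le[OF i(1)]]
      by (simp add: chunk_def)
    \<comment> \<open>A chunk may have fewer than \<open>q\<close> entries, so this position exists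
      only thanks to \<open>i < m\<close>.\<close>
    moreover have "i mod q < length (chunk (i div q))"
    proof -
      have "i mod q < m - i div q * q"
        using i(1) div_mult_mod_eq[of i q] by linarith
      then show ?thesis using \<open>0 < q\<close> Ts(1) by (simp add: chunk_def)
    qed
    ultimately have "Ts ! i \<in> set (chunk (i div q))" by (metis nth_mem)
    then have "v \<in> set (awalk_verts depot (concat (chunk (i div q))))"
      using tour_verts_subset_concat[OF tours] i(2) by blast
    then show "v \<in> visited (snd ?F)" using j by (auto simp: visited_def)
  qed
  moreover have "visited (snd ?F) \<subseteq> visited (fst ?F @ snd ?F)"
    unfolding visited_def by (rule UN_mono) simp_all
  ultimately have "customers \<subseteq> visited (fst ?F @ snd ?F)"
    using Ts(3) by (meson order_trans)
  then have F: "?F \<in> families m n customers"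
    using is_tour_Nil is_tour_concat[OF tours] by (auto simp: families_def)
  have "drone_time (concat (chunk j)) \<le> 1 / \<alpha> * real q * ?B" for j
  proof -
    have "truck_time (concat (chunk j)) \<le> real (length (chunk j)) * ?B"
      using truck_time_concat_le Ts(4) sub by (meson subsetD)
    \<comment> \<open>Short chunks are rounded up to \<open>q\<close> tours, which is sound since
      \<open>?B\<close> is nonnegative.\<close>
    also have "\<dots> \<le> real q * ?B"
      using B by (intro mult_right_mono) (simp_all add: chunk_def)
    finally show ?thesis
      using speed_pos by (simp add: drone_time_eq divide_right_mono)
  qed
  moreover have "truck_time [] \<le> 1 / \<alpha> * real q * ?B"
    using B speed_pos by (simp add: truck_time_def)
  ultimately have "makespan ?F \<le> 1 / \<alpha> * real q * ?B"
    using makespan_leI[OF F] assms(1) by auto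
  then show ?thesis
    using TSP_le_makespan[OF _ order_refl F] assms(1) by simp
qed

lemma drone_impact_le:
  assumes "1 \<le> k\<^sub>t" "1 \<le> k\<^sub>d" "D \<subseteq> customers"
  shows "drone_impact S k\<^sub>t k\<^sub>d D \<le> min 2 (1 / \<alpha> * of_int \<lceil>real k\<^sub>t / real k\<^sub>d\<rceil> + 1)"
proof -
  let ?B = "TSP k\<^sub>t 0 customers"
  \<comment> \<open>The ceiling is nonnegative, so \<open>nat\<close> keeps its value; this is the
    least \<open>q\<close> with \<open>k\<^sub>t \<le> k\<^sub>d * q\<close>.\<close>
  define q where "q = nat \<lceil>real k\<^sub>t / real k\<^sub>d\<rceil>"
  have q: "of_int \<lceil>real k\<^sub>t / real k\<^sub>d\<rceil> = real q"
    unfolding q_def by simp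
  have "real k\<^sub>t / real k\<^sub>d \<le> real q" unfolding q_def by linarith
  then have "real k\<^sub>t \<le> real (k\<^sub>d * q)"
    using assms(2) by (simp add: field_simps)
  then have "k\<^sub>t \<le> k\<^sub>d * q" by (simp only: of_nat_le_iff)
  note first = TSP_le_TSP_trucks[OF assms(1), of k\<^sub>d] TSP_le_drones[OF assms(1,2) this]
  \<comment> \<open>The missed nodes lie in \<open>D\<close>, hence in \<open>customers\<close>, and
    \<open>TSP\<close> is monotone in the set to be visited.\<close>
  have second: "TSP k\<^sub>t 0 (truck_missed S k\<^sub>t k\<^sub>d D) \<le> ?B"
    using assms(1,3) by (intro TSP_mono) (auto simp: truck_missed_def)
  have "Optimistic S k\<^sub>t k\<^sub>d D \<le> 2 * ?B"
    using first(1) second by (simp add: Optimistic_def)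
  moreover have "Optimistic S k\<^sub>t k\<^sub>d D \<le> (1 / \<alpha> * real q + 1) * ?B"
    using first(2) second unfolding Optimistic_def distrib_right by linarith
  ultimately show ?thesis
    unfolding drone_impact_def q min.bounded_iff
    using TSP_trucks_pos[OF assms(1)] by (simp only: pos_divide_le_eq)
qed

end

theorem lemma11:
  fixes S :: "'v selection" and k\<^sub>t k\<^sub>d :: nat and \<alpha> :: real
  assumes "selection_rule S" and "0 < \<alpha>" and "1 \<le> k\<^sub>t" and "1 \<le> k\<^sub>d"
  shows "worst_case_drone_impact S k\<^sub>t k\<^sub>d \<alpha>
    \<le> ereal (min 2 (1 / \<alpha> * of_int \<lceil>real k\<^sub>t / real k\<^sub>d\<rceil> + 1))"
  unfolding worst_case_drone_impact_def
  using relief_network.drone_impact_le[OF _ assms(3,4)]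
  \<comment> \<open>The bound is uniform in the network and in \<open>D\<close>, so it passes to the
    supremum. The deleted rules would push \<open>ereal\<close> into the \<open>min\<close> or split
    it, and the goal would no longer match the lemma.\<close>
  by (intro SUP_least) (clarsimp simp del: ereal_min min.bounded_iff)

end
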